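(* (Leray–Schauder continuation theorem for weak topologies) Let $E$ be a Banach space which is weakly normal and $w^*$-separable, let $U\subset E$ be weakly open and let $x_0\in U$. Let $F\colon(\overline{U}^w,w)\multimap(E,w)$ be a sequentially upper semicontinuous multimap with nonempty weakly compact convex values such that (a) $\bigcup_{\lambda\in[0,1]}\{x\in\overline{U}^w: x\in(1-\lambda)x_0+\lambda F(x)\}$ is relatively weakly compact; (b) for every $M\subset\overline{U}^w$ with $M\subset\overline{\operatorname{co}}(\{x_0\}\cup F(M))$, the set $M$ is relatively weakly compact; (c) for every $x\in\overline{U}^w\setminus U$ and every $\lambda\in[0,1]$, $x\notin(1-\lambda)x_0+\lambda F(x)$. Then $F$ has a fixed point, i.e. $\operatorname{Fix}(F)\neq\varnothing$.
   Context: $\overline{U}^w$ is the weak closure of $U$; $(X,w)$ denotes $X$ with the relative weak topology. $E$ is weakly normal if $(E,\sigma(E,E^* ))$ is a normal topological space, and $w^*$-separable means that the dual $E^*$ is separable in the weak$^*$ topology. Sequential upper semicontinuity is with respect to the weak topologies on domain and target. $\overline{\operatorname{co}}$ denotes closed convex hull. *)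

theory Defs
  imports "HOL-Analysis.Analysis"
begin

definition weak_topology :: "'a::real_normed_vector topology" where
  "weak_topology = topology_generated_by
     {{x. f x \<in> V} | (f :: 'a \<Rightarrow> real) V. bounded_linear f \<and> open V}"

definition dual_space :: "('a::real_normed_vector \<Rightarrow> real) set" where
  "dual_space = {f. bounded_linear f}"

definition weak_star_topology :: "('a::real_normed_vector \<Rightarrow> real) topology" where
  "weak_star_topology = subtopology (product_topology (\<lambda>_. euclideanreal) UNIV) dual_space"

definition weakly_normal :: "'a::real_normed_vector itself \<Rightarrow> bool" where
  "weakly_normal _ \<longleftrightarrow> normal_space (weak_topology :: 'a topology)"

definition w_star_separable :: "'a::real_normed_vector itself \<Rightarrow> bool" where
  "w_star_separable _ \<longleftrightarrow> (\<exists>D :: ('a \<Rightarrow> real) set. countable D \<and> D \<subseteq> dual_space \<and>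
      weak_star_topology closure_of D = topspace weak_star_topology)"

definition rel_weakly_compact :: "'a::real_normed_vector set \<Rightarrow> bool" where
  "rel_weakly_compact A \<longleftrightarrow> compactin weak_topology (weak_topology closure_of A)"

text \<open>Sequential upper semicontinuity of a multimap F : (D,w) -o (E,w):
  for every weakly closed B, the large preimage {x in D. F x meets B} is
  sequentially closed in (D,w); equivalently, small preimages of weakly open
  sets are sequentially open in (D,w).\<close>
definition seq_usc_weak :: "'a::real_normed_vector set \<Rightarrow> ('a \<Rightarrow> 'a set) \<Rightarrow> bool" where
  "seq_usc_weak D F \<longleftrightarrow> (\<forall>B. closedin weak_topology B \<longrightarrow>
     (\<forall>xs x. (\<forall>n. xs n \<in> D \<and> F (xs n) \<inter> B \<noteq> {}) \<and> x \<in> D \<and>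
             limitin weak_topology xs x sequentially \<longrightarrow> F x \<inter> B \<noteq> {}))"

definition homot_set :: "real \<Rightarrow> 'a::real_vector \<Rightarrow> 'a set \<Rightarrow> 'a set" where
  "homot_set l x0 A = {(1 - l) *\<^sub>R x0 + l *\<^sub>R y | y. y \<in> A}"

end

theory Submission
  imports Defs
begin

text \<open>
  Let \<open>C\<close> be the least closed convex set containing \<open>x0\<close> and \<open>F (C \<inter> D)\<close>, where \<open>D\<close> is the
  weak closure of \<open>U\<close>.  Minimality makes \<open>M = C \<inter> D\<close> satisfy the inclusion in (b), so \<open>M\<close> is weakly
  compact, and weakly metrizable because a weak-* dense sequence of functionals separates points.
  Urysohn's lemma on \<open>M\<close> gives \<open>\<phi>\<close> equal to 1 on the solutions of \<open>x \<in> (1 - \<lambda>) x0 + \<lambda> F x\<close> and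
  0 off \<open>U\<close>.  An approximate selection \<open>g\<close> of \<open>F\<close> on \<open>M\<close> takes values in a polytope in \<open>C\<close>, and
  \<open>z \<mapsto> (1 - \<phi> z) x0 + \<phi> z g z\<close>, continued by \<open>x0\<close> on \<open>C - U\<close>, has a fixed point in it by Brouwer's
  theorem.  Refining the selection and passing to a weak limit along a sequence in \<open>M\<close> yields
  \<open>x \<in> (1 - \<phi> x) x0 + \<phi> x F x\<close>, whence \<open>\<phi> x = 1\<close>.  Only \<open>M\<close> has to be weakly compact, so the
  Krein-Smulian theorem is not used.
\<close>

subsection \<open>Separation by continuous linear functionals\<close>

definition sublinear :: "('a::real_vector \<Rightarrow> real) \<Rightarrow> bool" where
  "sublinear p \<longleftrightarrow> (\<forall>x y. p (x + y) \<le> p x + p y) \<and> (\<forall>t x. 0 \<le> t \<longrightarrow> p (t *\<^sub>R x) = t * p x)"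

lemma sublinear_zero: "sublinear p \<Longrightarrow> p 0 = 0"
  unfolding sublinear_def by (metis mult_zero_left order_refl scaleR_zero_left)

lemma sublinear_minus_ge: "sublinear p \<Longrightarrow> - p (- x) \<le> p x"
  using sublinear_zero[of p] unfolding sublinear_def by (smt (verit) add.right_inverse)

text \<open>The reverse inequality is the assumed one with \<open>inverse t\<close> in place of
  \<open>t\<close>, applied to \<open>t *\<^sub>R x\<close>.\<close>

lemma sublinear_scaleI:
  fixes p :: "'a::real_vector \<Rightarrow> real"
  assumes "p 0 = 0" and le: "\<And>t x. 0 < t \<Longrightarrow> p (t *\<^sub>R x) \<le> t * p x" and "0 \<le> (t::real)"
  shows "p (t *\<^sub>R x) = t * p x"
proof (cases "t = 0")
  case False
  then have t: "0 < t" using assms by simp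
  then have "p (inverse t *\<^sub>R (t *\<^sub>R x)) \<le> inverse t * p (t *\<^sub>R x)"
    by (intro le) simp
  moreover have "inverse t *\<^sub>R (t *\<^sub>R x) = x" using t by simp
  ultimately have "p x \<le> inverse t * p (t *\<^sub>R x)" by (simp only:)
  then have "t * p x \<le> p (t *\<^sub>R x)" using t by (simp add: field_simps)
  then show ?thesis using le[OF t, of x] by simp
qed (use assms in simp)

text \<open>Lowers \<open>p\<close> along a ray: \<open>q x\<close> is the infimum of
  \<open>p (x + t *\<^sub>R y) - t * p y\<close> over \<open>t \<ge> 0\<close>, bounded below by
  \<open>- p (- x)\<close>. Taking \<open>t = 1\<close> at \<open>- y\<close> gives the last
  inequality, which forces a minimal sublinear functional to be odd.\<close>

lemma sublinear_shift:
  fixes p :: "'a::real_vector \<Rightarrow> real"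
  assumes p: "sublinear p"
  obtains q where "sublinear q" "\<And>x. q x \<le> p x" "q (- y) \<le> - p y"
proof -
  define S where "S x = {p (x + t *\<^sub>R y) - t * p y | t. 0 \<le> t}" for x
  define q where "q x = Inf (S x)" for x
  have sub: "p (a + b) \<le> p a + p b" and hom: "0 \<le> t \<Longrightarrow> p (t *\<^sub>R a) = t * p a" for a b t
    using p by (auto simp: sublinear_def)
  have lb: "- p (- x) \<le> s" if s: "s \<in> S x" for x s
  proof -
    obtain t where t: "0 \<le> t" "s = p (x + t *\<^sub>R y) - t * p y" using s by (auto simp: S_def)
    have "p (t *\<^sub>R y) \<le> p (x + t *\<^sub>R y) + p (- x)" using sub[of "x + t *\<^sub>R y" "- x"] by simp
    then show ?thesis using t hom[of t y] by simp
  qed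
  have bdd: "bdd_below (S x)" for x using lb by (rule bdd_belowI)
  have ne: "S x \<noteq> {}" for x by (auto simp: S_def)
  have qle: "q x \<le> p (x + t *\<^sub>R y) - t * p y" if "0 \<le> t" for x t
    unfolding q_def using that by (intro cInf_lower bdd) (auto simp: S_def)
  have approx: "\<exists>t\<ge>0. p (x + t *\<^sub>R y) - t * p y < q x + e" if "0 < e" for x e
  proof -
    obtain s where "s \<in> S x" "s < q x + e"
      using cInf_lessD[OF ne[of x], of "q x + e"] \<open>0 < e\<close> unfolding q_def by auto
    then show ?thesis by (auto simp: S_def)
  qed
  have q0: "q 0 = 0"
  proof (rule antisym)
    show "q 0 \<le> 0" using qle[of 0 0] sublinear_zero[OF p] by simp
    show "0 \<le> q 0" unfolding q_def using lb[of _ 0] sublinear_zero[OF p] by (intro cInf_greatest ne) simp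
  qed
  have "sublinear q"
    unfolding sublinear_def
  proof (intro conjI allI impI)
    fix a b
    show "q (a + b) \<le> q a + q b"
    proof (rule field_le_epsilon)
      fix e :: real assume "0 < e"
      then obtain t s where t: "t \<ge> 0" "p (a + t *\<^sub>R y) - t * p y < q a + e/2"
        and s: "s \<ge> 0" "p (b + s *\<^sub>R y) - s * p y < q b + e/2"
        using approx[of "e/2"] by (meson half_gt_zero)
      have "q (a + b) \<le> p ((a + b) + (t + s) *\<^sub>R y) - (t + s) * p y" using t s by (intro qle) simp
      also have "(a + b) + (t + s) *\<^sub>R y = (a + t *\<^sub>R y) + (b + s *\<^sub>R y)" by (simp add: algebra_simps)
      finally show "q (a + b) \<le> q a + q b + e"
        using sub[of "a + t *\<^sub>R y" "b + s *\<^sub>R y"] t s by (simp add: algebra_simps)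
    qed
  next
    fix t x assume t: "0 \<le> (t::real)"
    have "q (t *\<^sub>R x) \<le> t * q x" if t: "0 < t" for t x
    proof (rule field_le_epsilon)
      fix e :: real assume "0 < e"
      then obtain s where s: "s \<ge> 0" "p (x + s *\<^sub>R y) - s * p y < q x + e / t"
        using approx[of "e/t"] t by auto
      have "q (t *\<^sub>R x) \<le> p (t *\<^sub>R x + (t * s) *\<^sub>R y) - (t * s) * p y" using t s by (intro qle) simp
      also have "t *\<^sub>R x + (t * s) *\<^sub>R y = t *\<^sub>R (x + s *\<^sub>R y)" by (simp add: algebra_simps)
      also have "p (t *\<^sub>R (x + s *\<^sub>R y)) - (t * s) * p y = t * (p (x + s *\<^sub>R y) - s * p y)"
        using t hom[of t "x + s *\<^sub>R y"] by (simp add: right_diff_distrib)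
      also have "\<dots> \<le> t * (q x + e / t)" using s t by (intro mult_left_mono) auto
      finally show "q (t *\<^sub>R x) \<le> t * q x + e" using t by (simp add: algebra_simps)
    qed
    then show "q (t *\<^sub>R x) = t * q x" using t by (intro sublinear_scaleI q0)
  qed
  moreover have "q x \<le> p x" for x using qle[of 0 x] by simp
  moreover have "q (- y) \<le> - p y" using qle[of 1 "- y"] sublinear_zero[OF p] by simp
  ultimately show thesis using that by blast
qed

text \<open>The pointwise infimum works: a fixed member \<open>r\<close> supplies the lower bound
  \<open>- r (- x)\<close>, and for subadditivity two nearly optimal members are comparable, so the
  smaller one serves for both.\<close>

lemma sublinear_chain_Inf:
  fixes C :: "('a::real_vector \<Rightarrow> real) set"
  assumes ne: "C \<noteq> {}" and sub: "\<And>q. q \<in> C \<Longrightarrow> sublinear q"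
    and chain: "\<And>q r. q \<in> C \<Longrightarrow> r \<in> C \<Longrightarrow> q \<le> r \<or> r \<le> q"
  obtains u where "sublinear u" "\<And>q. q \<in> C \<Longrightarrow> u \<le> q"
proof -
  obtain r where r: "r \<in> C" using ne by blast
  define u where "u x = (INF q\<in>C. q x)" for x
  have lb: "- r (- x) \<le> q x" if q: "q \<in> C" for q x
    using chain[OF q r] sublinear_minus_ge[OF sub[OF q], of x] sublinear_minus_ge[OF sub[OF r], of x]
    by (auto simp: le_fun_def) (smt (verit))+
  have bdd: "bdd_below ((\<lambda>q. q x) ` C)" for x
    using lb by (intro bdd_belowI2)
  have ule: "u x \<le> q x" if "q \<in> C" for q x
    unfolding u_def using that by (intro cINF_lower bdd)
  have approx: "\<exists>q\<in>C. q x < u x + e" if "0 < e" for x e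
    using cInf_lessD[of "(\<lambda>q. q x) ` C" "u x + e"] that ne unfolding u_def by auto
  have "sublinear u"
    unfolding sublinear_def
  proof (intro conjI allI impI)
    fix a b
    show "u (a + b) \<le> u a + u b"
    proof (rule field_le_epsilon)
      fix e :: real assume "0 < e"
      then obtain q s where q: "q \<in> C" "q a < u a + e/2" and s: "s \<in> C" "s b < u b + e/2"
        using approx[of "e/2"] by (meson half_gt_zero)
      have "\<exists>z\<in>C. z a \<le> q a \<and> z b \<le> s b"
        using chain[OF q(1) s(1)] q s by (auto simp: le_fun_def)
      then obtain z where z: "z \<in> C" "z a \<le> q a" "z b \<le> s b" by blast
      have "z (a + b) \<le> z a + z b" using sub[OF z(1)] by (simp add: sublinear_def)
      then show "u (a + b) \<le> u a + u b + e" using ule[OF z(1), of "a+b"] z q s by simp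
    qed
  next
    fix t x assume t: "0 \<le> (t::real)"
    have u0: "u 0 = 0" unfolding u_def using ne by (simp add: sublinear_zero sub cong: image_cong_simp)
    have "u (t *\<^sub>R x) \<le> t * u x" if t: "0 < t" for t x
    proof (rule field_le_epsilon)
      fix e :: real assume "0 < e"
      then obtain q where q: "q \<in> C" "q x < u x + e / t"
        using approx[of "e/t"] t by auto
      have "u (t *\<^sub>R x) \<le> t * q x"
        using ule[OF q(1), of "t *\<^sub>R x"] sub[OF q(1)] t by (simp add: sublinear_def)
      also have "\<dots> \<le> t * (u x + e / t)" using q t by (intro mult_left_mono) auto
      finally show "u (t *\<^sub>R x) \<le> t * u x + e" using t by (simp add: algebra_simps)
    qed
    then show "u (t *\<^sub>R x) = t * u x" using t by (intro sublinear_scaleI u0)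
  qed
  then show thesis using that[of u] ule by (simp add: le_fun_def)
qed

text \<open>Hahn-Banach without extension from a subspace. Zorn's lemma gives a minimal sublinear
  \<open>m \<le> p\<close>; \<open>sublinear_shift\<close> makes it odd, and subadditivity at
  \<open>- a\<close> and \<open>- b\<close> then yields additivity.\<close>

theorem sublinear_dominates_linear:
  fixes p :: "'a::real_vector \<Rightarrow> real"
  assumes p: "sublinear p"
  obtains f where "linear f" "\<And>x. f x \<le> p x"
proof -
  define A where "A = {q. sublinear q \<and> q \<le> p}"
  \<comment> \<open>The order is reversed, so that the maximal element from Zorn's lemma is a
    minimal functional.\<close>
  have "\<exists>m\<in>A. \<forall>a\<in>A. m \<ge> a \<longrightarrow> a = m"
  proof (rule predicate_Zorn)
    show "partial_order_on A (relation_of (\<ge>) A)"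
      by (rule partial_order_on_relation_ofI) auto
    fix C assume C: "C \<in> Chains (relation_of (\<ge>) A)"
    show "\<exists>u\<in>A. \<forall>a\<in>C. u \<le> a"
    proof (cases "C = {}")
      case True
      then show ?thesis using p by (auto simp: A_def)
    next
      case False
      have CA: "q \<in> A" if "q \<in> C" for q using C that by (auto simp: Chains_def relation_of_def)
      obtain u where u: "sublinear u" "\<And>q. q \<in> C \<Longrightarrow> u \<le> q"
        by (rule sublinear_chain_Inf[OF False])
          (use CA C in \<open>auto simp: A_def Chains_def relation_of_def\<close>)
      then have "u \<in> A" using False CA by (fastforce simp: A_def intro: order_trans)
      then show ?thesis using u by blast
    qed
  qed
  then obtain m where m: "sublinear m" "m \<le> p" and min: "\<And>q. sublinear q \<Longrightarrow> q \<le> m \<Longrightarrow> q = m"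
    unfolding A_def by (metis (mono_tags, lifting) mem_Collect_eq order_trans)
  have minus: "m (- y) = - m y" for y
  proof -
    obtain q where q: "sublinear q" "\<And>x. q x \<le> m x" "q (- y) \<le> - m y" using sublinear_shift[OF m(1), of y] by blast
    then have "q = m" by (intro min) (auto simp: le_fun_def)
    then show ?thesis using q sublinear_minus_ge[OF m(1), of "- y"] by simp
  qed
  have sub: "m (a + b) \<le> m a + m b" and hom: "0 \<le> t \<Longrightarrow> m (t *\<^sub>R a) = t * m a" for a b t
    using m by (auto simp: sublinear_def)
  have "linear m"
  proof (rule linearI)
    show "m (a + b) = m a + m b" for a b
      using sub[of a b] sub[of "- a" "- b"] minus[of "a + b"] minus[of a] minus[of b] by simp
    show "m (t *\<^sub>R a) = t *\<^sub>R m a" for t a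
      using hom[of t a] hom[of "- t" a] minus[of "t *\<^sub>R a"] by (cases "0 \<le> t") auto
  qed
  then show thesis using that m by (simp add: le_fun_def)
qed

text \<open>Applied to the distance-type functional
  \<open>p v = inf {\<parallel>v + t c\<parallel> - t d | t \<ge> 0, c \<in> C}\<close> with \<open>d\<close> the distance from 0 to \<open>C\<close>,
  which spares the Minkowski gauge.\<close>
lemma separate_zero_from_convex:
  fixes C :: "'a::real_normed_vector set"
  assumes C: "convex C" "C \<noteq> {}" and d: "0 < d" "\<And>c. c \<in> C \<Longrightarrow> d \<le> norm c"
  obtains f where "bounded_linear f" "\<And>c. c \<in> C \<Longrightarrow> d \<le> f c"
proof -
  define S where "S v = {norm (v + t *\<^sub>R c) - t * d | t c. 0 \<le> t \<and> c \<in> C}" for v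
  define p where "p v = Inf (S v)" for v
  \<comment> \<open>The infimum is finite because
    \<open>t * d \<le> norm (t *\<^sub>R c)\<close>.\<close>
  have lb: "- norm v \<le> s" if s: "s \<in> S v" for v s
  proof -
    obtain t c where t: "0 \<le> t" "c \<in> C" "s = norm (v + t *\<^sub>R c) - t * d" using s by (auto simp: S_def)
    have "t * d \<le> norm (t *\<^sub>R c)" using d(2)[OF t(2)] t by (simp add: mult_left_mono)
    then show ?thesis using norm_triangle_ineq4[of "v + t *\<^sub>R c" v] t by simp
  qed
  have bdd: "bdd_below (S x)" for x using lb by (rule bdd_belowI)
  have ne: "S x \<noteq> {}" for x using C by (auto simp: S_def)
  have ple: "p v \<le> norm (v + t *\<^sub>R c) - t * d" if "0 \<le> t" "c \<in> C" for v t c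
    unfolding p_def using that by (intro cInf_lower bdd) (auto simp: S_def)
  have approx: "\<exists>t c. t\<ge>0 \<and> c \<in> C \<and> norm (v + t *\<^sub>R c) - t * d < p v + e" if "0 < e" for v e
  proof -
    obtain s where "s \<in> S v" "s < p v + e"
      using cInf_lessD[OF ne[of v], of "p v + e"] \<open>0 < e\<close> unfolding p_def by auto
    then show ?thesis by (auto simp: S_def)
  qed
  obtain c0 where c0: "c0 \<in> C" using C by blast
  have pn: "p v \<le> norm v" for v using ple[of 0 c0 v] c0 by simp
  have p0: "p 0 = 0"
  proof (rule antisym)
    show "p 0 \<le> 0" using pn[of 0] by simp
    show "0 \<le> p 0" unfolding p_def using lb[of _ 0] by (intro cInf_greatest ne) simp
  qed
  have "sublinear p"
    unfolding sublinear_def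
  proof (intro conjI allI impI)
    fix a b
    show "p (a + b) \<le> p a + p b"
    proof (rule field_le_epsilon)
      fix e :: real assume "0 < e"
      then obtain t c s c' where t: "t \<ge> 0" "c \<in> C" "norm (a + t *\<^sub>R c) - t * d < p a + e/2"
        and s: "s \<ge> 0" "c' \<in> C" "norm (b + s *\<^sub>R c') - s * d < p b + e/2"
        using approx[of "e/2"] by (meson half_gt_zero)
      \<comment> \<open>Convexity merges the two multiples into a single multiple of a point of
        \<open>C\<close>; when \<open>t + s = 0\<close> any point of \<open>C\<close>
        serves.\<close>
      obtain c'' where c'': "c'' \<in> C" "(t + s) *\<^sub>R c'' = t *\<^sub>R c + s *\<^sub>R c'"
      proof (cases "t + s = 0")
        case True
        then have "t = 0" "s = 0" using t s by auto
        then show ?thesis using that[of c0] c0 by simp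
      next
        case False
        have "(t / (t + s)) *\<^sub>R c + (s / (t + s)) *\<^sub>R c' \<in> C"
          using False t s by (intro convexD[OF C(1)]) (auto simp: add_divide_distrib[symmetric])
        moreover have "(t + s) *\<^sub>R ((t / (t + s)) *\<^sub>R c + (s / (t + s)) *\<^sub>R c') = t *\<^sub>R c + s *\<^sub>R c'"
          using False by (simp add: scaleR_right_distrib)
        ultimately show ?thesis using that by blast
      qed
      have "p (a + b) \<le> norm ((a + b) + (t + s) *\<^sub>R c'') - (t + s) * d"
        using t s c'' by (intro ple) auto
      also have "(a + b) + (t + s) *\<^sub>R c'' = (a + t *\<^sub>R c) + (b + s *\<^sub>R c')" by (simp add: c'')
      finally show "p (a + b) \<le> p a + p b + e"
        using norm_triangle_ineq[of "a + t *\<^sub>R c" "b + s *\<^sub>R c'"] t s by (simp add: algebra_simps)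
    qed
  next
    fix t x assume t: "0 \<le> (t::real)"
    have "p (t *\<^sub>R x) \<le> t * p x" if t: "0 < t" for t x
    proof (rule field_le_epsilon)
      fix e :: real assume "0 < e"
      then obtain s c where s: "s \<ge> 0" "c \<in> C" "norm (x + s *\<^sub>R c) - s * d < p x + e / t"
        using approx[of "e/t"] t by force
      have "p (t *\<^sub>R x) \<le> norm (t *\<^sub>R x + (t * s) *\<^sub>R c) - (t * s) * d" using t s by (intro ple) auto
      also have "t *\<^sub>R x + (t * s) *\<^sub>R c = t *\<^sub>R (x + s *\<^sub>R c)" by (simp add: algebra_simps)
      also have "norm (t *\<^sub>R (x + s *\<^sub>R c)) - (t * s) * d = t * (norm (x + s *\<^sub>R c) - s * d)"
        using t by (simp add: right_diff_distrib)
      also have "\<dots> \<le> t * (p x + e / t)" using s t by (intro mult_left_mono) auto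
      finally show "p (t *\<^sub>R x) \<le> t * p x + e" using t by (simp add: algebra_simps)
    qed
    then show "p (t *\<^sub>R x) = t * p x" using t by (intro sublinear_scaleI p0)
  qed
  then obtain f where f: "linear f" "\<And>x. f x \<le> p x" using sublinear_dominates_linear by blast
  have fle: "f v \<le> norm v" for v using f(2)[of v] pn[of v] by simp
  have "bounded_linear f"
  proof (rule bounded_linear_intro[where K = 1])
    show "norm (f v) \<le> norm v * 1" for v
      using fle[of v] fle[of "- v"] linear_neg[OF f(1), of v] by (simp add: abs_le_iff)
  qed (use f in \<open>auto simp: linear_add linear_scale\<close>)
  \<comment> \<open>With \<open>t = 1\<close> and \<open>v = - c\<close> the infimum gives
    \<open>p (- c) \<le> - d\<close>, hence \<open>f (- c) \<le> - d\<close>.\<close>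
  moreover have "d \<le> f c" if "c \<in> C" for c
    using ple[of 1 c "- c"] that f(2)[of "- c"] linear_neg[OF f(1), of c] by simp
  ultimately show thesis using that by blast
qed

text \<open>Translation moves \<open>x\<close> to 0, and \<open>d\<close> is the radius of a ball
  around \<open>x\<close> that misses \<open>C\<close>. The level \<open>f x + d / 2\<close> makes
  both inequalities strict.\<close>

lemma separate_point_from_closed_convex:
  fixes C :: "'a::real_normed_vector set"
  assumes C: "convex C" "closed C" and x: "x \<notin> C"
  obtains f :: "'a \<Rightarrow> real" and c where "bounded_linear f" "f x < c" "\<forall>y\<in>C. c < f y"
proof (cases "C = {}")
  case True
  then show ?thesis using that[of "\<lambda>_. 0" 1] by simp
next
  case False
  obtain d where d: "0 < d" "ball x d \<subseteq> - C"
    using C x by (metis Compl_iff open_Compl open_contains_ball)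
  have "convex ((\<lambda>y. y - x) ` C)" using C(1) by (simp add: convex_translation_subtract)
  then obtain f where f: "bounded_linear f" "\<And>c. c \<in> (\<lambda>y. y - x) ` C \<Longrightarrow> d \<le> f c"
  proof (rule separate_zero_from_convex)
    show "(\<lambda>y. y - x) ` C \<noteq> {}" using False by simp
    show "d \<le> norm c" if "c \<in> (\<lambda>y. y - x) ` C" for c
      using that d by (force simp: dist_norm norm_minus_commute subset_iff)
  qed (use d in auto)
  have "f x + d \<le> f y" if "y \<in> C" for y
    using f(2)[of "y - x"] that bounded_linear.linear[OF f(1)] by (auto simp: linear_diff)
  then show ?thesis using that[of f "f x + d / 2"] f(1) d(1) by force
qed

subsection \<open>The weak topology\<close>

lemma topspace_weak_topology [simp]: "topspace weak_topology = UNIV"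
  unfolding weak_topology_def topology_generated_by_topspace
  using bounded_linear_zero open_UNIV by blast

lemma continuous_map_weak_functional:
  fixes f :: "'a::real_normed_vector \<Rightarrow> real"
  assumes "bounded_linear f"
  shows "continuous_map weak_topology euclideanreal f"
proof -
  have "openin weak_topology {x. f x \<in> V}" if "open V" for V
    unfolding weak_topology_def by (rule topology_generated_by_Basis) (use assms that in blast)
  then show ?thesis by (simp add: continuous_map_def)
qed

text \<open>The functionals in the subbase are norm continuous. Hence weakly open and weakly closed
  sets are norm open and norm closed.\<close>

lemma continuous_map_euclidean_weak: "continuous_map euclidean weak_topology (\<lambda>x. x)"
proof -
  have "open {x::'a. f x \<in> V}" if "bounded_linear f" "open V" for f :: "'a \<Rightarrow> real" and V
    using open_vimage[OF that(2) linear_continuous_on[OF that(1)]] by (simp add: vimage_def)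
  moreover have "\<Union> {{x::'a. f x \<in> V} | (f :: 'a \<Rightarrow> real) V. bounded_linear f \<and> open V} = UNIV"
    using topspace_weak_topology unfolding weak_topology_def topology_generated_by_topspace .
  ultimately show ?thesis
    unfolding weak_topology_def continuous_on_generated_topo_iff by (auto simp: vimage_def)
qed

lemma openin_weak_imp_open: "openin weak_topology S \<Longrightarrow> open S"
  using continuous_map_euclidean_weak[unfolded continuous_map_def] by auto

lemma closedin_weak_imp_closed: "closedin weak_topology S \<Longrightarrow> closed S"
  using openin_weak_imp_open[of "- S"] by (simp add: closedin_def closed_def Compl_eq_Diff_UNIV)

lemma limitin_weak_functional:
  fixes f :: "'a::real_normed_vector \<Rightarrow> real"
  assumes "limitin weak_topology X x F" "bounded_linear f"
  shows "((\<lambda>n. f (X n)) \<longlongrightarrow> f x) F"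
  using continuous_map_limit[OF continuous_map_weak_functional[OF assms(2)] assms(1)]
  by (simp add: comp_def)

lemma closedin_weak_halfspace:
  fixes f :: "'a::real_normed_vector \<Rightarrow> real"
  assumes "bounded_linear f"
  shows "closedin weak_topology {x. c \<le> f x}"
  using closedin_continuous_map_preimage[OF continuous_map_weak_functional[OF assms], of "{c..}"] by simp

text \<open>Mazur's theorem: each point outside \<open>C\<close> is cut off by a weakly closed
  half-space containing \<open>C\<close>.\<close>

lemma closed_convex_imp_closedin_weak:
  fixes C :: "'a::real_normed_vector set"
  assumes "closed C" "convex C"
  shows "closedin weak_topology C"
proof -
  have "C = \<Inter> {S. closedin weak_topology S \<and> C \<subseteq> S}" (is "C = ?R")
  proof
    show "?R \<subseteq> C"
    proof
      fix x assume x: "x \<in> ?R"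
      show "x \<in> C"
      proof (rule ccontr)
        assume "x \<notin> C"
        obtain f :: "'a \<Rightarrow> real" and c where f: "bounded_linear f" "f x < c" "\<forall>y\<in>C. c < f y"
          by (rule separate_point_from_closed_convex[OF assms(2,1) \<open>x \<notin> C\<close>])
        have "C \<subseteq> {x. c \<le> f x}" using f(3) by (auto intro: less_imp_le)
        then have "x \<in> {x. c \<le> f x}" using x closedin_weak_halfspace[OF f(1), of c] by blast
        then show False using f by simp
      qed
    qed
  qed blast
  moreover have "closedin weak_topology ?R" using closedin_topspace[of weak_topology]
    by (intro closedin_Inter) auto
  ultimately show ?thesis by simp
qed

lemma Hausdorff_weak_topology: "Hausdorff_space (weak_topology :: 'a::real_normed_vector topology)"
  unfolding Hausdorff_space_def
proof (intro allI impI)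
  fix x y :: 'a assume "x \<in> topspace weak_topology \<and> y \<in> topspace weak_topology \<and> x \<noteq> y"
  then have "x \<notin> {y}" by simp
  then obtain f :: "'a \<Rightarrow> real" and c where f: "bounded_linear f" "f x < c" "c < f y"
    using separate_point_from_closed_convex[of "{y}" x] by auto
  have o: "openin weak_topology {z. f z \<in> V}" if "open V" for V
    using openin_continuous_map_preimage[OF continuous_map_weak_functional[OF f(1)], of V] that by simp
  show "\<exists>U V. openin weak_topology U \<and> openin weak_topology V \<and> x \<in> U \<and> y \<in> V \<and> disjnt U V"
    using o[of "{..<c}"] o[of "{c<..}"] f(2,3)
    by (intro exI[of _ "{z. f z \<in> {..<c}}"] exI[of _ "{z. f z \<in> {c<..}}"]) (auto simp: disjnt_iff)
qed

text \<open>For fixed \<open>x\<close> and \<open>y\<close> the evaluation difference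
  \<open>g x - g y\<close> is weak-* continuous in \<open>g\<close>. If it vanishes on the dense set
  \<open>D\<close>, it vanishes on the whole dual, against the separation of two distinct
  points.\<close>

lemma w_star_separable_imp_separating_sequence:
  assumes "w_star_separable TYPE('a::real_normed_vector)"
  shows "\<exists>e :: nat \<Rightarrow> 'a::real_normed_vector \<Rightarrow> real. (\<forall>n. bounded_linear (e n)) \<and> (\<forall>x y. (\<forall>n. e n x = e n y) \<longrightarrow> x = y)"
proof -
  obtain D :: "('a \<Rightarrow> real) set" where D: "countable D" "D \<subseteq> dual_space"
    "weak_star_topology closure_of D = topspace weak_star_topology"
    using assms unfolding w_star_separable_def by blast
  have ts: "topspace (weak_star_topology :: ('a \<Rightarrow> real) topology) = dual_space"
    by (simp add: weak_star_topology_def)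
  \<comment> \<open>The zero functional ensures that the enumerated set is nonempty.\<close>
  define e where "e = from_nat_into (insert (\<lambda>_. 0) D)"
  have re: "range e = insert (\<lambda>_. 0) D" unfolding e_def using D(1) by (intro range_from_nat_into) auto
  have "x = y" if eq: "\<forall>n. e n x = e n y" for x y
  proof (rule ccontr)
    assume "x \<noteq> y"
    then have "x \<notin> {y}" by simp
    then obtain f :: "'a \<Rightarrow> real" and c where f: "bounded_linear f" "f x < c" "c < f y"
      using separate_point_from_closed_convex[of "{y}" x] by auto
    have cm: "continuous_map weak_star_topology euclideanreal (\<lambda>g::'a\<Rightarrow>real. g z)" for z
      unfolding weak_star_topology_def
      by (intro continuous_map_from_subtopology continuous_map_product_projection) simp
    have "closedin weak_star_topology {g \<in> topspace weak_star_topology. g x - g y \<in> {0}}"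
      by (rule closedin_continuous_map_preimage[OF continuous_map_diff[OF cm cm]]) simp
    moreover have "D \<subseteq> {g \<in> topspace weak_star_topology. g x - g y \<in> {0}}"
      using D(2) eq re ts by (auto simp: image_iff) (metis insertCI rangeE)
    ultimately have "topspace weak_star_topology \<subseteq> {g \<in> topspace weak_star_topology. g x - g y \<in> {0}}"
      unfolding D(3)[symmetric] by (intro closure_of_minimal)
    moreover have "f \<in> topspace weak_star_topology" using f ts by (simp add: dual_space_def)
    ultimately show False using f by auto
  qed
  moreover have "bounded_linear (e n)" for n
  proof -
    have "e n \<in> insert (\<lambda>_. 0) D" using re by blast
    then show ?thesis using D(2) bounded_linear_zero by (auto simp: dual_space_def)
  qed
  ultimately show ?thesis by (intro exI[of _ e]) simp
qed

text \<open>A separating sequence maps \<open>M\<close> continuously and injectively into a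
  countable product of lines; a compact source and a Hausdorff target make this map an
  embedding.\<close>

lemma weakly_compact_imp_metrizable:
  fixes M :: "'a::real_normed_vector set"
  assumes sep: "w_star_separable TYPE('a)" and M: "compactin weak_topology M"
  shows "metrizable_space (subtopology weak_topology M)"
proof -
  obtain e :: "nat \<Rightarrow> 'a \<Rightarrow> real" where e: "\<forall>n. bounded_linear (e n)"
    "\<forall>x y. (\<forall>n. e n x = e n y) \<longrightarrow> x = y"
    using w_star_separable_imp_separating_sequence[OF sep] by (elim exE conjE)
  let ?P = "product_topology (\<lambda>_::nat. euclideanreal) UNIV"
  have P: "metrizable_space ?P"
    by (simp add: metrizable_space_product_topology metrizable_space_euclidean)
  have "embedding_map (subtopology weak_topology M) ?P (\<lambda>x n. e n x)"
  proof (rule continuous_imp_embedding_map)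
    show "continuous_map (subtopology weak_topology M) ?P (\<lambda>x n. e n x)"
      by (auto simp: continuous_map_componentwise_UNIV
          intro!: continuous_map_from_subtopology continuous_map_weak_functional e(1)[rule_format])
    show "compact_space (subtopology weak_topology M)" using M by (simp add: compact_space_subtopology)
    show "Hausdorff_space ?P" using P by (rule metrizable_imp_Hausdorff_space)
    show "inj_on (\<lambda>x n. e n x) (topspace (subtopology weak_topology M))"
      using e(2) by (auto simp: inj_on_def fun_eq_iff)
  qed
  from embedding_map_imp_homeomorphic_space[OF this] show ?thesis
    using homeomorphic_metrizable_space metrizable_space_subtopology[OF P] by blast
qed

subsection \<open>Fixed points of finite-dimensional maps\<close>

text \<open>Brouwer's theorem for cubes whose dimension is a term; \<open>brouwer\<close> fixes it by the type.\<close>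
lemma cube_fixed_point:
  fixes h :: "(nat \<Rightarrow> real) \<Rightarrow> nat \<Rightarrow> real" and n :: nat
  defines "K \<equiv> PiE UNIV (\<lambda>i. if i < n then {0..1} else {0::real})"
  assumes cont: "\<And>i. i < n \<Longrightarrow> continuous_on K (\<lambda>w. h w i)"
    and range: "\<And>w i. w \<in> K \<Longrightarrow> i < n \<Longrightarrow> h w i \<in> {0..1}"
  obtains w where "w \<in> K" "\<forall>i<n. h w i = w i"
proof -
  have K_iff: "w \<in> K \<longleftrightarrow> (\<forall>i<n. 0 \<le> w i \<and> w i \<le> 1) \<and> (\<forall>i. \<not> i < n \<longrightarrow> w i = 0)" for w
  proof -
    have "w \<in> K \<longleftrightarrow> (\<forall>i. w i \<in> (if i < n then {0..1} else {0}))" by (simp add: K_def PiE_iff)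
    also have "\<dots> \<longleftrightarrow> (\<forall>i. (i < n \<longrightarrow> 0 \<le> w i \<and> w i \<le> 1) \<and> (\<not> i < n \<longrightarrow> w i = 0))"
      by (intro all_cong1) simp
    finally show ?thesis by blast
  qed
  have "compactin (product_topology (\<lambda>i. euclidean) UNIV) K"
    unfolding K_def by (subst compactin_PiE) auto
  then have "compact K" by (simp add: euclidean_product_topology)
  then have seqK: "seq_compact K" by (simp add: compact_eq_seq_compact_metric)
  \<comment> \<open>Mesh points with \<open>p\<close> subdivisions per axis, encoded by integer
    vectors; coordinates from \<open>n\<close> on are 0, as membership in \<open>K\<close>
    demands.\<close>
  define grid :: "nat \<Rightarrow> (nat \<Rightarrow> nat) \<Rightarrow> nat \<Rightarrow> real"
    where "grid p x i = (if i < n then x i / p else 0)" for p x i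
  have gridK: "grid p x \<in> K" if "0 < p" "\<forall>i<n. x i \<le> p" for p x
    using that by (simp add: K_iff grid_def)
  \<comment> \<open>Label 0 records that \<open>h\<close> does not decrease the coordinate. The
    clause \<open>x i \<noteq> p\<close> forces label 1 on the top face, a boundary condition of
    Kuhn's lemma; \<open>label1\<close> survives there because \<open>h\<close> is at most
    1.\<close>
  define label :: "nat \<Rightarrow> (nat \<Rightarrow> nat) \<Rightarrow> nat \<Rightarrow> nat"
    where "label p x i = (if x i \<noteq> p \<and> grid p x i \<le> h (grid p x) i then 0 else 1)" for p x i
  have label0: "grid p x i \<le> h (grid p x) i" if "label p x i = 0" for p x i
    using that by (auto simp: label_def split: if_splits)
  have label1: "h (grid p x) i \<le> grid p x i"
    if "label p x i \<noteq> 0" "0 < p" "\<forall>i<n. x i \<le> p" "i < n" for p x i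
    using that range[OF gridK[OF that(2,3)] that(4)]
    by (auto simp: label_def grid_def split: if_splits)
  define near :: "nat \<Rightarrow> (nat \<Rightarrow> nat) \<Rightarrow> (nat \<Rightarrow> nat) \<Rightarrow> bool"
    where "near p q r \<longleftrightarrow> (\<forall>j<n. r j \<le> p) \<and> (\<forall>j. dist (grid p r j) (grid p q j) \<le> 1 / p)" for p q r
  \<comment> \<open>For each coordinate, grid points close to a good \<open>q\<close> show both weak
    signs of \<open>h\<close> minus the identity.\<close>
  define good :: "nat \<Rightarrow> (nat \<Rightarrow> nat) \<Rightarrow> bool"
    where "good p q \<longleftrightarrow> (\<forall>i<n. q i \<le> p) \<and> (\<forall>i<n. \<exists>r s. near p q r \<and> near p q s \<and>
      grid p r i \<le> h (grid p r) i \<and> h (grid p s) i \<le> grid p s i)" for p q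
  have "\<exists>q. good p q"
    if p: "0 < p" for p
  proof -
    obtain q where q: "\<forall>i<n. q i < p"
      "\<forall>i<n. \<exists>r s. (\<forall>j<n. q j \<le> r j \<and> r j \<le> q j + 1) \<and> (\<forall>j<n. q j \<le> s j \<and> s j \<le> q j + 1) \<and>
        label p r i \<noteq> label p s i"
    proof (rule kuhn_lemma[OF p, of n "label p"])
      show "\<forall>x. (\<forall>i<n. x i \<le> p) \<longrightarrow> (\<forall>i<n. x i = 0 \<longrightarrow> label p x i = 0)"
        using p range gridK by (auto simp: label_def grid_def)
    qed (auto simp: label_def)
    have close: "dist (grid p r j) (grid p q j) \<le> 1 / p"
      if "\<forall>j<n. q j \<le> r j \<and> r j \<le> q j + 1" for r j
      using that p by (auto simp: grid_def dist_real_def diff_divide_distrib[symmetric] divide_right_mono)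
    have "\<exists>r s. near p q r \<and> near p q s \<and>
      grid p r i \<le> h (grid p r) i \<and> h (grid p s) i \<le> grid p s i" if i: "i < n" for i
    proof -
      obtain r s where rs: "\<forall>j<n. q j \<le> r j \<and> r j \<le> q j + 1" "\<forall>j<n. q j \<le> s j \<and> s j \<le> q j + 1"
        "label p r i \<noteq> label p s i" using q(2) i by blast
      have "r j \<le> p" "s j \<le> p" if "j < n" for j
        using rs(1,2)[rule_format, OF that] q(1)[rule_format, OF that] by simp_all
      then have le: "\<forall>j<n. r j \<le> p" "\<forall>j<n. s j \<le> p" by simp_all
      then have near: "near p q r" "near p q s" using close rs unfolding near_def by blast+
      show ?thesis
      proof (cases "label p r i = 0")
        case True
        then have "label p s i \<noteq> 0" using rs(3) by simp
        then show ?thesis using near label0[OF True] label1[OF _ p le(2) i] by blast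
      next
        case False
        then have "label p s i = 0" using rs(3) by (auto simp: label_def split: if_splits)
        then show ?thesis using near label0 label1[OF False p le(1) i] by blast
      qed
    qed
    then have "good p q" using q(1) less_imp_le unfolding good_def by blast
    then show ?thesis by blast
  qed
  then obtain q where good: "\<And>p. 0 < p \<Longrightarrow> good p (q p)" by metis
  have q: "\<forall>i<n. q p i \<le> p"
    "\<And>i. i < n \<Longrightarrow> \<exists>r s. near p (q p) r \<and> near p (q p) s \<and>
      grid p r i \<le> h (grid p r) i \<and> h (grid p s) i \<le> grid p s i" if "0 < p" for p
    using good[OF that] unfolding good_def by blast+
  \<comment> \<open>\<open>Suc m\<close> keeps the number of subdivisions positive. Compactness of
    \<open>K\<close> then extracts a limit \<open>w\<close> as the mesh is refined.\<close>
  have "\<forall>m. grid (Suc m) (q (Suc m)) \<in> K"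
    using gridK[OF zero_less_Suc q(1)[OF zero_less_Suc]] by blast
  then obtain w \<rho> where w: "w \<in> K" "strict_mono \<rho>"
    "((\<lambda>m. grid (Suc m) (q (Suc m))) \<circ> \<rho>) \<longlonglongrightarrow> w"
    by (rule seq_compactE[OF seqK])
  have wlim: "(\<lambda>m. grid (Suc (\<rho> m)) (q (Suc (\<rho> m))) j) \<longlonglongrightarrow> w j" for j
    using continuous_on_tendsto_compose[OF continuous_on_product_coordinates w(3)] by (simp add: comp_def)
  have small: "(\<lambda>m. 1 / real (Suc (\<rho> m))) \<longlonglongrightarrow> 0"
    using LIMSEQ_subseq_LIMSEQ[OF LIMSEQ_inverse_real_of_nat w(2)] by (simp add: comp_def inverse_eq_divide)
  \<comment> \<open>Grid points near the chosen ones share their limit, since the mesh size tends to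
    0.\<close>
  have lim: "(\<lambda>m. grid (Suc (\<rho> m)) (z m)) \<longlonglongrightarrow> w"
    if z: "\<And>m. near (Suc (\<rho> m)) (q (Suc (\<rho> m))) (z m)" for z
  proof -
    have "(\<lambda>m. grid (Suc (\<rho> m)) (z m) j) \<longlonglongrightarrow> w j" for j
    proof (rule Lim_transform[OF wlim])
      show "(\<lambda>m. grid (Suc (\<rho> m)) (z m) j - grid (Suc (\<rho> m)) (q (Suc (\<rho> m))) j) \<longlonglongrightarrow> 0"
        by (rule Lim_null_comparison[OF _ small])
          (intro always_eventually allI, use z in \<open>simp add: near_def dist_real_def\<close>)
    qed
    then have "limitin (product_topology (\<lambda>i. euclidean) UNIV) (\<lambda>m. grid (Suc (\<rho> m)) (z m)) w sequentially"
      by (simp add: limitin_componentwise)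
    then show ?thesis by (simp add: euclidean_product_topology)
  qed
  \<comment> \<open>Two sequences with opposite inequalities both tend to \<open>w\<close>, and
    continuity of \<open>h\<close> passes the inequalities to the limit.\<close>
  have "h w i = w i" if i: "i < n" for i
  proof (rule antisym)
    have "\<forall>m. \<exists>r s. near (Suc (\<rho> m)) (q (Suc (\<rho> m))) r \<and> near (Suc (\<rho> m)) (q (Suc (\<rho> m))) s \<and>
      grid (Suc (\<rho> m)) r i \<le> h (grid (Suc (\<rho> m)) r) i \<and> h (grid (Suc (\<rho> m)) s) i \<le> grid (Suc (\<rho> m)) s i"
      using q(2)[OF zero_less_Suc i] by blast
    then obtain r s where rs: "\<And>m. near (Suc (\<rho> m)) (q (Suc (\<rho> m))) (r m)"
        "\<And>m. near (Suc (\<rho> m)) (q (Suc (\<rho> m))) (s m)"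
        "\<And>m. grid (Suc (\<rho> m)) (r m) i \<le> h (grid (Suc (\<rho> m)) (r m)) i"
        "\<And>m. h (grid (Suc (\<rho> m)) (s m)) i \<le> grid (Suc (\<rho> m)) (s m) i"
      by metis
    let ?r = "\<lambda>m. grid (Suc (\<rho> m)) (r m)" and ?s = "\<lambda>m. grid (Suc (\<rho> m)) (s m)"
    have r: "?r \<longlonglongrightarrow> w" by (rule lim[OF rs(1)])
    have s: "?s \<longlonglongrightarrow> w" by (rule lim[OF rs(2)])
    have rK: "?r m \<in> K" and sK: "?s m \<in> K" for m
      using gridK rs(1,2) by (auto simp: near_def)
    have hr: "(\<lambda>m. h (?r m) i) \<longlonglongrightarrow> h w i"
      by (rule continuous_on_tendsto_compose[OF cont[OF i] r w(1)]) (use rK in simp)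
    have hs: "(\<lambda>m. h (?s m) i) \<longlonglongrightarrow> h w i"
      by (rule continuous_on_tendsto_compose[OF cont[OF i] s w(1)]) (use sK in simp)
    have ri: "(\<lambda>m. ?r m i) \<longlonglongrightarrow> w i"
      using continuous_on_tendsto_compose[OF continuous_on_product_coordinates r] by simp
    have si: "(\<lambda>m. ?s m i) \<longlonglongrightarrow> w i"
      using continuous_on_tendsto_compose[OF continuous_on_product_coordinates s] by simp
    show "w i \<le> h w i" by (rule LIMSEQ_le[OF ri hr]) (use rs(3) in blast)
    show "h w i \<le> w i" by (rule LIMSEQ_le[OF hs si]) (use rs(4) in blast)
  qed
  then show thesis using that w(1) by blast
qed

text \<open>Brouwer's theorem is applied to coefficient vectors: \<open>w\<close> in the cube
  determines a point \<open>X w\<close> of \<open>C\<close>, and the weights \<open>q\<close> at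
  that point form the image vector.\<close>

lemma finite_dimensional_fixed_point:
  fixes C U M :: "'a::real_normed_vector set" and q :: "nat \<Rightarrow> 'a \<Rightarrow> real"
  assumes C: "convex C" "x0 \<in> C" "\<And>i. i < n \<Longrightarrow> y i \<in> C"
    and U: "open U" "x0 \<in> U" and M: "closed M" "C \<inter> U \<subseteq> M"
    and cont: "\<And>i. i < n \<Longrightarrow> continuous_on M (q i)"
    and q: "\<And>i z. i < n \<Longrightarrow> z \<in> M \<Longrightarrow> 0 \<le> q i z" "\<And>z. z \<in> M \<Longrightarrow> (\<Sum>i<n. q i z) \<le> 1"
    and van: "\<And>i z. i < n \<Longrightarrow> z \<in> M \<Longrightarrow> z \<notin> U \<Longrightarrow> q i z = 0"
  shows "\<exists>z\<in>M. z = x0 + (\<Sum>i<n. q i z *\<^sub>R (y i - x0))"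
proof -
  define K where "K = PiE UNIV (\<lambda>i. if i < n then {0..1} else {0::real})"
  have K_nonneg: "0 \<le> w i" if "w \<in> K" for w i
  proof -
    have "w i \<in> (if i < n then {0..1} else {0})" using that unfolding K_def by (rule PiE_mem) simp
    then show ?thesis by (auto split: if_splits)
  qed
  \<comment> \<open>Division by the maximum keeps \<open>X w\<close> in \<open>C\<close> for every
    \<open>w\<close> in the cube. It changes nothing once the coefficients sum to at most 1, as they
    do at the fixed point.\<close>
  define X where "X w = x0 + (\<Sum>i<n. (w i / max 1 (\<Sum>i<n. w i)) *\<^sub>R (y i - x0))" for w :: "nat \<Rightarrow> real"
  have "closedin (product_topology (\<lambda>i. euclidean) UNIV) K"
    unfolding K_def by (subst closedin_product_topology) auto
  then have closedK: "closed K" by (simp add: euclidean_product_topology)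
  have coord: "continuous_on K (\<lambda>w. w i)" for i
    by (rule continuous_on_subset[OF continuous_on_product_coordinates]) simp
  have contX: "continuous_on K X"
    unfolding X_def by (intro continuous_intros coord) auto
  have XC: "X w \<in> C" if "w \<in> K" for w
  proof -
    define s where "s = max 1 (\<Sum>i<n. w i)"
    have s: "1 \<le> s" "(\<Sum>i<n. w i) \<le> s" by (auto simp: s_def)
    \<comment> \<open>Index \<open>n\<close> holds \<open>x0\<close> with the remaining weight, so
      that \<open>X w\<close> is a convex combination of \<open>Suc n\<close> points.\<close>
    define v where "v i = (if i < n then y i else x0)" for i
    define a where "a i = (if i < n then w i / s else 1 - (\<Sum>i<n. w i) / s)" for i
    have sum_a: "(\<Sum>i<n. a i) = (\<Sum>i<n. w i) / s" by (simp add: a_def sum_divide_distrib)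
    have "(\<Sum>i\<in>{..<Suc n}. a i *\<^sub>R v i) \<in> C"
    proof (rule convex_sum[OF _ C(1)])
      show "(\<Sum>i\<in>{..<Suc n}. a i) = 1" using sum_a by (simp add: a_def)
      show "0 \<le> a i" for i using K_nonneg[OF that, of i] s by (auto simp: a_def)
      show "v i \<in> C" for i using C by (simp add: v_def)
    qed simp
    also have "(\<Sum>i\<in>{..<Suc n}. a i *\<^sub>R v i) = (\<Sum>i<n. (w i / s) *\<^sub>R y i) + (1 - (\<Sum>i<n. w i / s)) *\<^sub>R x0"
      by (simp add: a_def v_def sum_divide_distrib)
    also have "\<dots> = X w"
      unfolding X_def s_def[symmetric]
      by (simp add: scaleR_right_diff_distrib scaleR_left_diff_distrib sum_subtractf scaleR_sum_left)
    finally show ?thesis .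
  qed
  define h where "h w i = (if X w \<in> M then q i (X w) else 0)" for w i
  have q1: "q i z \<le> 1" if "i < n" "z \<in> M" for i z
    using member_le_sum[of i "{..<n}" "\<lambda>i. q i z"] q that by force
  obtain w where w: "w \<in> K" "\<forall>i<n. h w i = w i"
  proof (rule cube_fixed_point[of n h, folded K_def])
    fix i assume i: "i < n"
    \<comment> \<open>Two closed pieces cover \<open>K\<close> because
      \<open>C \<inter> U \<subseteq> M\<close>; on their overlap \<open>X w\<close> lies in
      \<open>M - U\<close>, where the weights vanish, so the definitions agree.\<close>
    define K1 K2 where "K1 = K \<inter> X -` M" and "K2 = K \<inter> X -` (- U)"
    have closed: "closed K1" "closed K2"
      unfolding K1_def K2_def using contX closedK M(1) U(1)
      by (auto intro!: continuous_closed_preimage simp: closed_Compl)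
    have "continuous_on K1 (\<lambda>w. q i (X w))"
      by (rule continuous_on_compose2[OF cont[OF i]])
        (auto simp: K1_def intro: continuous_on_subset[OF contX])
    then have "continuous_on (K1 \<union> K2) (\<lambda>w. if X w \<in> M then q i (X w) else 0)"
      by (rule continuous_on_cases[OF closed _ continuous_on_const])
        (use van i in \<open>auto simp: K1_def K2_def\<close>)
    moreover have "K1 \<union> K2 = K" using XC M(2) by (auto simp: K1_def K2_def)
    ultimately show "continuous_on K (\<lambda>w. h w i)" by (simp add: h_def)
    show "h w i \<in> {0..1}" for w using q(1) q1 i by (auto simp: h_def)
  qed
  \<comment> \<open>Outside \<open>M\<close> all weights are 0, which would give
    \<open>X w = x0\<close>, a point of \<open>C \<inter> U\<close>.\<close>
  have "X w \<in> M"
  proof (rule ccontr)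
    assume "X w \<notin> M"
    then have "X w = x0" using w(2) by (auto simp: X_def h_def intro!: sum.neutral)
    then show False using \<open>X w \<notin> M\<close> C U M by auto
  qed
  then have wq: "w i = q i (X w)" if "i < n" for i using w(2) that by (simp add: h_def)
  then have "(\<Sum>i<n. w i) \<le> 1" using q(2)[OF \<open>X w \<in> M\<close>] by simp
  then have "X w = x0 + (\<Sum>i<n. w i *\<^sub>R (y i - x0))" by (simp add: X_def max_absorb1)
  also have "\<dots> = x0 + (\<Sum>i<n. q i (X w) *\<^sub>R (y i - x0))" using wq by simp
  finally show ?thesis using \<open>X w \<in> M\<close> by blast
qed

subsection \<open>Set-valued maps on weakly compact sets\<close>

lemma compactin_weak_imp_bdd_above:
  fixes f :: "'a::real_normed_vector \<Rightarrow> real"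
  assumes "compactin weak_topology K" "bounded_linear f"
  shows "bdd_above (f ` K)"
proof -
  have "compact (f ` K)"
    using image_compactin[OF assms(1) continuous_map_weak_functional[OF assms(2)]] by simp
  then show ?thesis by (rule bounded_imp_bdd_above[OF compact_imp_bounded])
qed

lemma convex_less_level:
  fixes f :: "'a::real_vector \<Rightarrow> real"
  assumes "linear f"
  shows "convex {x. f x < c}"
  using assms by (auto intro!: convexI simp: linear_add linear_scale convex_bound_lt)

lemma homot_set_eq_image: "homot_set l x0 K = (\<lambda>y. (1 - l) *\<^sub>R x0 + l *\<^sub>R y) ` K"
  by (auto simp: homot_set_def)

text \<open>Assumption \<open>ev\<close> says that \<open>y n\<close> eventually enters each open
  half-space containing \<open>K\<close>. If \<open>x\<close> were strictly separated from the
  closed convex set \<open>homot_set l' x0 K\<close>, such a half-space would bound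
  \<open>g (z n)\<close> and, in the limit, \<open>g x\<close>.\<close>

lemma homot_set_limit:
  fixes x0 :: "'a::real_normed_vector" and z y :: "nat \<Rightarrow> 'a"
  assumes K: "closed K" "convex K" "compactin weak_topology K" "K \<noteq> {}"
    and z: "limitin weak_topology z x sequentially"
    and l: "l \<longlonglongrightarrow> l'" "\<And>n. 0 \<le> l n"
    and eq: "\<And>n. z n = (1 - l n) *\<^sub>R x0 + l n *\<^sub>R y n"
    and ev: "\<And>(f :: 'a \<Rightarrow> real) c. bounded_linear f \<Longrightarrow> \<forall>v\<in>K. f v < c \<Longrightarrow> \<forall>\<^sub>F n in sequentially. f (y n) < c"
  shows "x \<in> homot_set l' x0 K"
proof (rule ccontr)
  let ?H = "homot_set l' x0 K"
  have image: "?H = (+) ((1 - l') *\<^sub>R x0) ` (*\<^sub>R) l' ` K" by (auto simp: homot_set_def)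
  have "closed ?H" unfolding image by (intro closed_translation closed_scaling K)
  moreover have "convex ?H" unfolding image by (intro convex_translation convex_scaling K)
  moreover assume "x \<notin> ?H"
  ultimately obtain f :: "'a \<Rightarrow> real" and c where f: "bounded_linear f" "f x < c" "\<forall>v\<in>?H. c < f v"
    using separate_point_from_closed_convex[of ?H x] by metis
  define g where "g v = - f v" for v
  have g: "bounded_linear g" unfolding g_def using f(1) by (rule bounded_linear_minus)
  have g_comb: "g ((1 - t) *\<^sub>R x0 + t *\<^sub>R v) = (1 - t) * g x0 + t * g v" for t v
    using bounded_linear.linear[OF g] by (simp add: linear_add linear_scale)
  have gH: "(1 - l') * g x0 + l' * g v < - c" if "v \<in> K" for v
    using f(3) that g_comb[of l' v] by (force simp: homot_set_eq_image g_def)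
  have l'0: "0 \<le> l'" using l by (intro LIMSEQ_le_const[OF l(1)]) auto
  \<comment> \<open>For \<open>l' > 0\<close> the bound is solved with equality. For
    \<open>l' = 0\<close> it does not involve \<open>b\<close>: any strict upper bound of
    \<open>g\<close> on \<open>K\<close> will do, and a point of \<open>K\<close> gives the
    inequality.\<close>
  obtain b where b: "\<forall>v\<in>K. g v < b" "(1 - l') * g x0 + l' * b \<le> - c"
  proof (cases "l' = 0")
    case False
    then have pos: "0 < l'" using l'0 by simp
    show thesis
      by (rule that[of "(- c - (1 - l') * g x0) / l'"])
        (use gH pos in \<open>simp_all add: field_simps\<close>)
  next
    case True
    obtain b where "\<And>v. v \<in> K \<Longrightarrow> g v \<le> b"
      using compactin_weak_imp_bdd_above[OF K(3) g] by (auto simp: bdd_above_def)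
    then show thesis
      using that[of "b + 1"] True K(4) gH by fastforce
  qed
  have "g x \<le> (1 - l') * g x0 + l' * b"
  proof (rule tendsto_le)
    show "(\<lambda>n. g (z n)) \<longlonglongrightarrow> g x" by (rule limitin_weak_functional[OF z g])
    show "(\<lambda>n. (1 - l n) * g x0 + l n * b) \<longlonglongrightarrow> (1 - l') * g x0 + l' * b"
      by (intro tendsto_intros l)
    show "\<forall>\<^sub>F n in sequentially. g (z n) \<le> (1 - l n) * g x0 + l n * b"
      using ev[OF g b(1)]
      by eventually_elim (subst eq, unfold g_comb, use l(2) in \<open>auto intro: mult_left_mono less_imp_le\<close>)
  qed simp
  then show False using b(2) f(2) by (simp add: g_def)
qed

text \<open>\<open>C\<close> is the intersection of all admissible sets. The closed hull
  \<open>C'\<close> lies in \<open>C\<close>, hence is admissible itself, and minimality gives the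
  last inclusion.\<close>

lemma least_invariant_closed_convex_set:
  fixes x0 :: "'a::real_normed_vector"
  obtains C where "closed C" "convex C" "x0 \<in> C" "\<Union>(F ` (C \<inter> D)) \<subseteq> C"
    "C \<subseteq> closure (convex hull ({x0} \<union> \<Union>(F ` (C \<inter> D))))"
proof -
  define Q where "Q = {K. closed K \<and> convex K \<and> x0 \<in> K \<and> \<Union>(F ` (K \<inter> D)) \<subseteq> K}"
  define C where "C = \<Inter>Q"
  define C' where "C' = closure (convex hull ({x0} \<union> \<Union>(F ` (C \<inter> D))))"
  have C: "closed C" "convex C" "x0 \<in> C" "\<Union>(F ` (C \<inter> D)) \<subseteq> C"
    unfolding C_def by (auto simp: Q_def intro!: convex_Inter)
  have sub: "{x0} \<union> \<Union>(F ` (C \<inter> D)) \<subseteq> C'"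
    unfolding C'_def using hull_subset closure_subset by (rule order_trans)
  have "C' \<subseteq> C"
    unfolding C'_def using C by (intro closure_minimal hull_minimal) auto
  then have "\<Union>(F ` (C' \<inter> D)) \<subseteq> \<Union>(F ` (C \<inter> D))" by blast
  then have "C' \<in> Q"
    unfolding Q_def using sub by (auto simp: C'_def convex_closure)
  then have "C \<subseteq> C'" unfolding C_def by blast
  then show thesis using that C unfolding C'_def by blast
qed

text \<open>The \<open>q i\<close> give Cellina's approximate selection of \<open>F\<close>, damped by \<open>\<phi>\<close>; their weights vanish outside \<open>U\<close>, so they extend continuously to \<open>C\<close>.\<close>
lemma approximate_fixed_point:
  fixes F :: "'a::real_normed_vector \<Rightarrow> 'a set" and M d
  assumes "Metric_space M d"
    and top: "Metric_space.mtopology M d = subtopology weak_topology M" and compact: "compactin (Metric_space.mtopology M d) M"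
    and C: "convex C" "x0 \<in> C" "\<And>z. z \<in> M \<Longrightarrow> F z \<noteq> {} \<and> F z \<subseteq> C"
    and U: "open U" "x0 \<in> U" and M: "closed M" "C \<inter> U \<subseteq> M"
    and \<phi>: "continuous_map (Metric_space.mtopology M d) euclideanreal \<phi>" "\<And>z. z \<in> M \<Longrightarrow> \<phi> z \<in> {0..1}"
      "\<And>z. z \<in> M \<Longrightarrow> z \<notin> U \<Longrightarrow> \<phi> z = 0"
    and "0 < \<epsilon>"
  shows "\<exists>z\<in>M. \<exists>w. w \<in> convex hull (\<Union>a\<in>Metric_space.mball M d z \<epsilon>. F a) \<and> z = (1 - \<phi> z) *\<^sub>R x0 + \<phi> z *\<^sub>R w"
proof -
  interpret Metric_space M d by fact
  have cont: "continuous_on M f" if "continuous_map mtopology euclideanreal f" for f :: "'a \<Rightarrow> real"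
  proof -
    have "continuous_map (top_of_set M) mtopology (\<lambda>x. x)"
      unfolding top by (intro continuous_map_into_subtopology continuous_map_from_subtopology
          continuous_map_euclidean_weak) auto
    from continuous_map_compose[OF this that] show ?thesis by (simp add: comp_def)
  qed
  obtain N where N: "finite N" "N \<subseteq> M" "M \<subseteq> (\<Union>a\<in>N. mball a \<epsilon>)"
    using compactin_imp_mtotally_bounded[OF compact, unfolded mtotally_bounded_def, rule_format, OF \<open>0 < \<epsilon>\<close>]
    by (elim exE conjE)
  define n where "n = card N"
  obtain a where a: "bij_betw a {..<n} N"
    using ex_bij_betw_nat_finite[OF N(1)] by (auto simp: n_def atLeast0LessThan)
  have aM: "a i \<in> M" if "i < n" for i using a N(2) that by (auto simp: bij_betw_def)
  define y where "y i = (SOME v. v \<in> F (a i))" for i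
  have y: "y i \<in> F (a i)" if "i < n" for i
    unfolding y_def using C(3)[OF aM[OF that]] by (simp add: some_in_eq)
  \<comment> \<open>Hat functions on the balls of the net. Their sum \<open>s\<close> is positive on
    \<open>M\<close> because the balls cover it, so the quotients form a partition of unity.\<close>
  define p where "p i z = max 0 (\<epsilon> - d (a i) z)" for i z
  define s where "s z = (\<Sum>i<n. p i z)" for z
  have p0: "0 \<le> p i z" for i z by (simp add: p_def)
  have s0: "0 < s z" if z: "z \<in> M" for z
  proof -
    obtain i where "i < n" "z \<in> mball (a i) \<epsilon>" using N(3) z a by (auto simp: bij_betw_def)
    then show ?thesis unfolding s_def using p0 by (intro sum_pos2[of _ i]) (auto simp: p_def)
  qed
  have cp: "continuous_on M (p i)" if "i < n" for i
  proof -
    have "continuous_map mtopology euclideanreal (d (a i))"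
      using continuous_on_mdist[of "a i" Self] aM[OF that] by (simp add: mtopology_of_def)
    from cont[OF this] show ?thesis unfolding p_def by (intro continuous_intros)
  qed
  have cs: "continuous_on M s"
    unfolding s_def by (intro continuous_on_sum cp) simp
  \<comment> \<open>Damping makes the total weight \<open>\<phi> z\<close>; the missing
    \<open>1 - \<phi> z\<close> falls to \<open>x0\<close>.\<close>
  define q where "q i z = \<phi> z * (p i z / s z)" for i z
  have sum_ps: "(\<Sum>i<n. p i z / s z) = 1" if "z \<in> M" for z
    using s0[OF that] by (simp add: s_def sum_divide_distrib[symmetric])
  have sum_q: "(\<Sum>i<n. q i z) = \<phi> z" if "z \<in> M" for z
    unfolding q_def sum_distrib_left[symmetric] sum_ps[OF that] by simp
  have "\<exists>z\<in>M. z = x0 + (\<Sum>i<n. q i z *\<^sub>R (y i - x0))"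
  proof (rule finite_dimensional_fixed_point[OF C(1,2) _ U M])
    show "y i \<in> C" if "i < n" for i using y[OF that] C(3)[OF aM[OF that]] by blast
    show "continuous_on M (q i)" if "i < n" for i
      unfolding q_def using s0
      by (intro continuous_on_mult continuous_on_divide cont[OF \<phi>(1)] cp[OF that] cs) force
    show "0 \<le> q i z" if "z \<in> M" for i z
      using \<phi>(2)[OF that] p0 s0[OF that] by (simp add: q_def)
    show "(\<Sum>i<n. q i z) \<le> 1" if "z \<in> M" for z
      using \<phi>(2)[OF that] sum_q[OF that] by simp
    show "q i z = 0" if "z \<in> M" "z \<notin> U" for i z using \<phi>(3)[OF that] by (simp add: q_def)
  qed
  then obtain z where z: "z \<in> M" "z = x0 + (\<Sum>i<n. q i z *\<^sub>R (y i - x0))" by blast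
  define w where "w = (\<Sum>i<n. (p i z / s z) *\<^sub>R y i)"
  \<comment> \<open>Only net points within \<open>\<epsilon>\<close> of \<open>z\<close> carry
    weight, so \<open>w\<close> averages values of \<open>F\<close> over the ball around
    \<open>z\<close>.\<close>
  have "w = (\<Sum>i\<in>{i. i < n \<and> p i z \<noteq> 0}. (p i z / s z) *\<^sub>R y i)"
    unfolding w_def by (rule sum.mono_neutral_right) auto
  also have "\<dots> \<in> convex hull (\<Union>a\<in>mball z \<epsilon>. F a)"
  proof (rule convex_sum)
    have "(\<Sum>i\<in>{i. i < n \<and> p i z \<noteq> 0}. p i z / s z) = (\<Sum>i<n. p i z / s z)"
      by (rule sum.mono_neutral_left) auto
    then show "(\<Sum>i\<in>{i. i < n \<and> p i z \<noteq> 0}. p i z / s z) = 1" using sum_ps[OF z(1)] by simp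
    show "y i \<in> convex hull (\<Union>a\<in>mball z \<epsilon>. F a)" if "i \<in> {i. i < n \<and> p i z \<noteq> 0}" for i
    proof (rule hull_inc)
      have "a i \<in> mball z \<epsilon>" using that aM z(1) commute by (auto simp: p_def max_def split: if_splits)
      then show "y i \<in> (\<Union>a\<in>mball z \<epsilon>. F a)" using y that by blast
    qed
  qed (use p0 s0[OF z(1)] in auto)
  finally have "w \<in> convex hull (\<Union>a\<in>mball z \<epsilon>. F a)" .
  moreover have "z = (1 - \<phi> z) *\<^sub>R x0 + \<phi> z *\<^sub>R w"
  proof -
    have "(\<Sum>i<n. q i z *\<^sub>R (y i - x0)) = (\<Sum>i<n. q i z *\<^sub>R y i) - (\<Sum>i<n. q i z) *\<^sub>R x0"
      by (simp add: scaleR_right_diff_distrib sum_subtractf scaleR_sum_left)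
    also have "(\<Sum>i<n. q i z *\<^sub>R y i) = \<phi> z *\<^sub>R w"
      by (simp add: w_def q_def scaleR_sum_right)
    finally have "(\<Sum>i<n. q i z *\<^sub>R (y i - x0)) = \<phi> z *\<^sub>R w - \<phi> z *\<^sub>R x0"
      unfolding sum_q[OF z(1)] .
    then show ?thesis
      by (intro trans[OF z(2)]) (simp add: scaleR_left_diff_distrib)
  qed
  ultimately show ?thesis using z(1) by blast
qed

text \<open>Metrizability turns the sequential condition into one on balls: if no radius worked,
  points tending to \<open>z\<close> would have values meeting the weakly closed half-space
  \<open>c \<le> f v\<close>, and so would \<open>F z\<close>.\<close>

lemma seq_usc_weak_imp_usc_functional:
  fixes F :: "'a::real_normed_vector \<Rightarrow> 'a set" and f :: "'a \<Rightarrow> real" and M d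
  assumes "Metric_space M d"
    and top: "Metric_space.mtopology M d = subtopology weak_topology M"
    and F: "seq_usc_weak D F" "M \<subseteq> D" and z: "z \<in> M"
    and f: "bounded_linear f" "\<forall>v\<in>F z. f v < c"
  shows "\<exists>\<delta>>0. \<forall>a\<in>Metric_space.mball M d z \<delta>. \<forall>v\<in>F a. f v < c"
proof (rule ccontr)
  interpret Metric_space M d by fact
  assume "\<not> ?thesis"
  then have neg: "\<exists>a\<in>mball z \<delta>. \<exists>v\<in>F a. c \<le> f v" if "0 < \<delta>" for \<delta>
    using that by (meson not_less)
  have "\<forall>n. \<exists>a. a \<in> mball z (inverse (real (Suc n))) \<and> F a \<inter> {v. c \<le> f v} \<noteq> {}"
  proof
    fix n
    show "\<exists>a. a \<in> mball z (inverse (real (Suc n))) \<and> F a \<inter> {v. c \<le> f v} \<noteq> {}"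
      using neg[of "inverse (real (Suc n))"] by auto
  qed
  then obtain a where a: "\<forall>n. a n \<in> mball z (inverse (real (Suc n))) \<and> F (a n) \<inter> {v. c \<le> f v} \<noteq> {}"
    by (rule choice[THEN exE])
  have "limitin mtopology a z sequentially"
    unfolding limitin_metric
  proof (intro conjI z allI impI)
    fix e :: real assume "0 < e"
    from order_tendstoD(2)[OF LIMSEQ_inverse_real_of_nat this]
    show "\<forall>\<^sub>F n in sequentially. a n \<in> M \<and> d (a n) z < e"
    proof eventually_elim
      case (elim n)
      have "a n \<in> mball z (inverse (real (Suc n)))" using a by blast
      then show ?case using elim commute[of z "a n"] unfolding in_mball by linarith
    qed
  qed
  then have "limitin weak_topology a z sequentially" by (simp add: top limitin_subtopology)
  moreover have "\<forall>n. a n \<in> D \<and> F (a n) \<inter> {v. c \<le> f v} \<noteq> {}"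
    using a F(2) by auto
  ultimately have "F z \<inter> {v. c \<le> f v} \<noteq> {}"
    using F z closedin_weak_halfspace[OF f(1), of c] unfolding seq_usc_weak_def by blast
  then show False using f(2) by fastforce
qed

section \<open>Compactness of the least invariant set and passage to an exact fixed point\<close>

theorem theorem3p8:
  fixes U :: "'a::banach set" and x0 :: 'a and F :: "'a \<Rightarrow> 'a set"
  assumes "weakly_normal TYPE('a)"
    and "w_star_separable TYPE('a)"
    and "openin weak_topology U"
    and "x0 \<in> U"
    and "seq_usc_weak (weak_topology closure_of U) F"
    and "\<And>x. x \<in> weak_topology closure_of U \<Longrightarrow>
           F x \<noteq> {} \<and> compactin weak_topology (F x) \<and> convex (F x)"
    and "rel_weakly_compact
           (\<Union>l\<in>{0..1}. {x \<in> weak_topology closure_of U. x \<in> homot_set l x0 (F x)})"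
    and "\<And>M. M \<subseteq> weak_topology closure_of U \<Longrightarrow>
           M \<subseteq> closure (convex hull ({x0} \<union> \<Union>(F ` M))) \<Longrightarrow> rel_weakly_compact M"
    and "\<And>x l. x \<in> weak_topology closure_of U - U \<Longrightarrow> l \<in> {0..1} \<Longrightarrow>
           x \<notin> homot_set l x0 (F x)"
  shows "\<exists>x \<in> weak_topology closure_of U. x \<in> F x"
proof -
  let ?D = "weak_topology closure_of U"
  have UD: "U \<subseteq> ?D" by (simp add: closure_of_subset)
  obtain C where C: "closed C" "convex C" "x0 \<in> C" "\<Union>(F ` (C \<inter> ?D)) \<subseteq> C"
    "C \<subseteq> closure (convex hull ({x0} \<union> \<Union>(F ` (C \<inter> ?D))))"
    by (rule least_invariant_closed_convex_set[of x0 F ?D])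
  define M where "M = C \<inter> ?D"
  have closedM: "closedin weak_topology M"
    unfolding M_def by (intro closedin_Int closed_convex_imp_closedin_weak C closedin_closure_of)
  \<comment> \<open>The inclusion \<open>C(5)\<close> is the premise of (b) for \<open>M\<close>.
    Since \<open>M\<close> is weakly closed, relative weak compactness is weak compactness.\<close>
  have "rel_weakly_compact M"
    using assms(8)[of M] C(5) by (auto simp: M_def)
  then have compactM: "compactin weak_topology M"
    unfolding rel_weakly_compact_def closure_of_closedin[OF closedM] .
  obtain S d where "Metric_space S d" and top_S: "subtopology weak_topology M = Metric_space.mtopology S d"
    using weakly_compact_imp_metrizable[OF assms(2) compactM] unfolding metrizable_space_def by blast
  then have "S = M"
    using Metric_space.topspace_mtopology[of S d] by (metis topspace_subtopology topspace_weak_topology Int_UNIV_left)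
  interpret Metric_space M d using \<open>Metric_space S d\<close> \<open>S = M\<close> by simp
  have top: "mtopology = subtopology weak_topology M" using top_S \<open>S = M\<close> by simp
  have compact: "compactin mtopology M"
    using compactM by (simp add: top compactin_subtopology)
  have weak_lim: "limitin weak_topology \<sigma> z sequentially" if "limitin mtopology \<sigma> z sequentially" for \<sigma> z
    using that by (simp add: top limitin_subtopology)
  have MD: "M \<subseteq> ?D" by (simp add: M_def)
  have Fz: "closed (F z)" "convex (F z)" "compactin weak_topology (F z)" "F z \<noteq> {}" if "z \<in> M" for z
    using assms(6)[of z] that MD
      closedin_weak_imp_closed[OF compactin_imp_closedin[OF Hausdorff_weak_topology]] by auto
  \<comment> \<open>The limit argument for approximate solutions serves twice: for the closedness of
    \<open>A\<close> and for the final sequence.\<close>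
  have limit: "z \<in> homot_set l x0 (F z)"
    if \<sigma>: "limitin mtopology \<sigma> z sequentially" and l: "t \<longlonglongrightarrow> l" "\<And>n. 0 \<le> t n"
      and eq: "\<And>n. \<sigma> n = (1 - t n) *\<^sub>R x0 + t n *\<^sub>R y n"
      and y: "\<And>n. y n \<in> convex hull (\<Union>a\<in>mball (\<sigma> n) (\<epsilon> n). F a)" and \<epsilon>: "\<epsilon> \<longlonglongrightarrow> 0"
    for \<sigma> z t l y and \<epsilon> :: "nat \<Rightarrow> real"
  proof -
    have zM: "z \<in> M" using \<sigma> by (simp add: limitin_metric)
    have "\<forall>\<^sub>F n in sequentially. f (y n) < c"
      if f: "bounded_linear f" "\<forall>v\<in>F z. f v < c" for f :: "'a \<Rightarrow> real" and c
    proof -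
      obtain \<delta> where \<delta>: "0 < \<delta>" "\<forall>a\<in>mball z \<delta>. \<forall>v\<in>F a. f v < c"
        using seq_usc_weak_imp_usc_functional[OF Metric_space_axioms top assms(5) MD zM f] by blast
      have "\<forall>\<^sub>F n in sequentially. \<sigma> n \<in> M \<and> d (\<sigma> n) z < \<delta> / 2"
        using \<sigma> half_gt_zero[OF \<delta>(1)] unfolding limitin_metric by blast
      moreover have "\<forall>\<^sub>F n in sequentially. \<epsilon> n < \<delta> / 2"
        using \<epsilon> \<delta>(1) by (intro order_tendstoD) auto
      ultimately show ?thesis
      proof eventually_elim
        case (elim n)
        \<comment> \<open>Both distances are below \<open>\<delta> / 2\<close>, so the values over
          the small ball, and their convex hull, stay in the half-space
          \<open>f v < c\<close>.\<close>
        have "mball (\<sigma> n) (\<epsilon> n) \<subseteq> mball z \<delta>"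
        proof
          fix a assume a: "a \<in> mball (\<sigma> n) (\<epsilon> n)"
          then have "d z a \<le> d (\<sigma> n) z + d (\<sigma> n) a"
            using triangle[of z "\<sigma> n" a] zM commute[of z "\<sigma> n"] by simp
          then show "a \<in> mball z \<delta>" using a elim zM by simp
        qed
        then have "(\<Union>a\<in>mball (\<sigma> n) (\<epsilon> n). F a) \<subseteq> {v. f v < c}" using \<delta>(2) by blast
        then have "convex hull (\<Union>a\<in>mball (\<sigma> n) (\<epsilon> n). F a) \<subseteq> {v. f v < c}"
          by (rule hull_minimal) (rule convex_less_level[OF bounded_linear.linear[OF f(1)]])
        then show "f (y n) < c" using y by blast
      qed
    qed
    then show ?thesis by (rule homot_set_limit[OF Fz[OF zM] weak_lim[OF \<sigma>] l eq])
  qed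
  have subseq: "\<exists>z r. z \<in> M \<and> strict_mono r \<and> limitin mtopology (\<sigma> \<circ> r) z sequentially"
    if "\<And>n. \<sigma> n \<in> M" for \<sigma> :: "nat \<Rightarrow> 'a"
    using compact that unfolding compactin_sequentially by blast
  define A where "A = {z \<in> M. \<exists>l\<in>{0..1}. z \<in> homot_set l x0 (F z)}"
  have inv_lim: "(\<lambda>n. inverse (real (Suc n))) \<longlonglongrightarrow> 0" by (rule LIMSEQ_inverse_real_of_nat)
  \<comment> \<open>The parameters have a convergent subsequence, and exact values count as
    approximate ones because each centre lies in its own ball.\<close>
  have "closedin mtopology A"
    unfolding metric_closedin_iff_sequentially_closed
  proof (intro conjI allI impI)
    show "A \<subseteq> M" by (auto simp: A_def)
    fix \<sigma> z assume "range \<sigma> \<subseteq> A \<and> limitin mtopology \<sigma> z sequentially"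
    then have \<sigma>A: "\<And>n. \<sigma> n \<in> A" and \<sigma>: "limitin mtopology \<sigma> z sequentially" by auto
    have "\<forall>n. \<exists>t y. t \<in> {0..1} \<and> y \<in> F (\<sigma> n) \<and> \<sigma> n = (1 - t) *\<^sub>R x0 + t *\<^sub>R y"
    proof
      fix n
      obtain t where "t \<in> {0..1}" "\<sigma> n \<in> homot_set t x0 (F (\<sigma> n))"
        using \<sigma>A[of n] unfolding A_def by blast
      then show "\<exists>t y. t \<in> {0..1} \<and> y \<in> F (\<sigma> n) \<and> \<sigma> n = (1 - t) *\<^sub>R x0 + t *\<^sub>R y"
        unfolding homot_set_eq_image by blast
    qed
    then obtain t y where t: "\<forall>n. t n \<in> {0..1} \<and> y n \<in> F (\<sigma> n) \<and> \<sigma> n = (1 - t n) *\<^sub>R x0 + t n *\<^sub>R y n"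
      by metis
    obtain l r where l: "l \<in> {0..1}" "strict_mono r" "(t \<circ> r) \<longlonglongrightarrow> l"
      using t compact_Icc[of 0 "1::real"] unfolding compact_eq_seq_compact_metric by (metis seq_compactE)
    have "z \<in> homot_set l x0 (F z)"
    proof (rule limit[OF limitin_subsequence[OF l(2) \<sigma>] l(3) _ _ _ inv_lim])
      show "0 \<le> (t \<circ> r) n" "(\<sigma> \<circ> r) n = (1 - (t \<circ> r) n) *\<^sub>R x0 + (t \<circ> r) n *\<^sub>R (y \<circ> r) n" for n
        using t by auto
      have "\<sigma> m \<in> M" for m using \<sigma>A by (auto simp: A_def)
      then show "(y \<circ> r) n \<in> convex hull (\<Union>a\<in>mball ((\<sigma> \<circ> r) n) (inverse (real (Suc n))). F a)" for n
        using t by (intro hull_inc) auto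
    qed
    then show "z \<in> A" using l(1) \<sigma> by (auto simp: A_def limitin_metric)
  qed
  moreover have "closedin mtopology (M - U)"
  proof -
    have "M - U = M - M \<inter> U" by blast
    moreover have "openin mtopology (M \<inter> U)"
      unfolding top by (rule openin_subtopology_Int2[OF assms(3)])
    ultimately show ?thesis using openin_closedin_eq closedin_diff by (metis closedin_topspace topspace_mtopology)
  qed
  \<comment> \<open>Condition (c) keeps solutions for every parameter off
    \<open>M - U\<close>.\<close>
  moreover have "disjnt (M - U) A"
    using assms(9) MD by (auto simp: disjnt_iff A_def)
  moreover have "normal_space mtopology"
    by (intro metrizable_imp_normal_space metrizable_space_mtopology)
  ultimately obtain \<phi> where \<phi>: "continuous_map mtopology (top_of_set {0..1::real}) \<phi>"
    "\<phi> ` (M - U) \<subseteq> {0}" "\<phi> ` A \<subseteq> {1}"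
    using Urysohn_lemma[of mtopology "M - U" A 0 1] by auto
  have \<phi>_cont: "continuous_map mtopology euclideanreal \<phi>"
    and \<phi>_range: "\<phi> z \<in> {0..1}" if "z \<in> M" for z
    using \<phi>(1) that by (auto simp: continuous_map_in_subtopology)
  have "\<forall>n. \<exists>z w. z \<in> M \<and> w \<in> convex hull (\<Union>a\<in>mball z (inverse (real (Suc n))). F a)
      \<and> z = (1 - \<phi> z) *\<^sub>R x0 + \<phi> z *\<^sub>R w"
  proof
    fix n
    have "\<exists>z\<in>M. \<exists>w. w \<in> convex hull (\<Union>a\<in>mball z (inverse (real (Suc n))). F a)
      \<and> z = (1 - \<phi> z) *\<^sub>R x0 + \<phi> z *\<^sub>R w"
    proof (rule approximate_fixed_point[OF Metric_space_axioms top compact C(2,3) _ openin_weak_imp_open[OF assms(3)] assms(4)])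
      show "F z \<noteq> {} \<and> F z \<subseteq> C" if "z \<in> M" for z
        using Fz(4)[OF that] C(4) that by (auto simp: M_def)
      show "closed M" using closedM by (rule closedin_weak_imp_closed)
      show "C \<inter> U \<subseteq> M" using UD by (auto simp: M_def)
      show "continuous_map mtopology euclideanreal \<phi>" using \<phi>(1) by (simp add: continuous_map_in_subtopology)
    qed (use \<phi>(2) \<phi>_range in auto)
    then show "\<exists>z w. z \<in> M \<and> w \<in> convex hull (\<Union>a\<in>mball z (inverse (real (Suc n))). F a)
      \<and> z = (1 - \<phi> z) *\<^sub>R x0 + \<phi> z *\<^sub>R w" by blast
  qed
  then obtain z w where zw: "\<forall>n. z n \<in> M \<and> w n \<in> convex hull (\<Union>a\<in>mball (z n) (inverse (real (Suc n))). F a)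
      \<and> z n = (1 - \<phi> (z n)) *\<^sub>R x0 + \<phi> (z n) *\<^sub>R w n"
    by metis
  obtain x r where x: "x \<in> M" "strict_mono r" "limitin mtopology (z \<circ> r) x sequentially"
    using subseq[of z] zw by blast
  \<comment> \<open>Continuity of \<open>\<phi>\<close> along the subsequence identifies the
    limiting parameter as \<open>\<phi> x\<close>.\<close>
  have "x \<in> homot_set (\<phi> x) x0 (F x)"
  proof (rule limit[OF x(3)])
    have "continuous_map mtopology euclideanreal \<phi>" using \<phi>(1) by (simp add: continuous_map_in_subtopology)
    from continuous_map_limit[OF this x(3)] show "(\<lambda>n. \<phi> (z (r n))) \<longlonglongrightarrow> \<phi> x" by (simp add: comp_def)
    show "(\<lambda>n. inverse (real (Suc (r n)))) \<longlonglongrightarrow> 0"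
      using LIMSEQ_subseq_LIMSEQ[OF inv_lim x(2)] by (simp add: comp_def)
    show "0 \<le> \<phi> (z (r n))" for n using zw \<phi>_range by auto
    show "(z \<circ> r) n = (1 - \<phi> (z (r n))) *\<^sub>R x0 + \<phi> (z (r n)) *\<^sub>R w (r n)" for n
      unfolding comp_def using zw by blast
    show "w (r n) \<in> convex hull (\<Union>a\<in>mball ((z \<circ> r) n) (inverse (real (Suc (r n)))). F a)" for n
      unfolding comp_def using zw by blast
  qed
  \<comment> \<open>As \<open>\<phi> x\<close> lies in the unit interval, the limit belongs to
    \<open>A\<close>, where \<open>\<phi>\<close> is 1; at parameter 1 the homotopy set is
    \<open>F x\<close> itself.\<close>
  moreover from this have "x \<in> A" using x(1) \<phi>_range unfolding A_def by blast
  then have "\<phi> x = 1" using \<phi>(3) by blast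
  ultimately have "x \<in> F x" by (simp add: homot_set_eq_image)
  then show ?thesis using x(1) MD by blast
qed

end
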